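(* Let $n\ge1$, $\tau\in[0,1]$, and $\tilde g_1,\tilde g_2\in\mathbb{R}^n$ with $\tilde g_2\ne0$. Then the two-objective ($K=2$) PCD direction is $$\tilde d^*=\begin{cases}\tilde g_1 & \text{if } \tilde g_2^\top\tilde g_1\ge\tau\|\tilde g_2\|^2,\\[4pt] \tilde g_1+\Bigl(\tau-\dfrac{\tilde g_2^\top\tilde g_1}{\|\tilde g_2\|^2}\Bigr)\tilde g_2 & \text{otherwise.}\end{cases}$$
   Context: $\|\cdot\|$ is the Euclidean norm. For $K=2$, the PCD direction is the solution of the quadratic program $\tilde d^*=\arg\min\{\|d-\tilde g_1\|^2: d\in\mathbb{R}^n,\ \tilde g_2^\top d\ge\tau\|\tilde g_2\|^2\}$. *)

theory Defs
  imports "HOL-Analysis.Analysis"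
begin

definition pcd_feasible :: "real \<Rightarrow> real ^ 'n \<Rightarrow> real ^ 'n \<Rightarrow> bool" where
  "pcd_feasible \<tau> g2 d \<longleftrightarrow> g2 \<bullet> d \<ge> \<tau> * (norm g2)\<^sup>2"

text \<open>The set of all minimizers of the quadratic program that defines the two-objective
  PCD direction. The paper's equation d* = argmin (\<dots>) is read as: this set is the singleton
  containing d*.\<close>
definition pcd_argmin :: "real \<Rightarrow> real ^ 'n \<Rightarrow> real ^ 'n \<Rightarrow> (real ^ 'n) set" where
  "pcd_argmin \<tau> g1 g2 = {d. is_arg_min (\<lambda>d. (norm (d - g1))\<^sup>2) (pcd_feasible \<tau> g2) d}"

end

(* The feasible set is a half-space, and the claimed point p differs from g1 by a nonnegative
   multiple of its normal g2. Hence p satisfies the variational inequality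
   (p - g1) . (d - p) >= 0 for all feasible d, which characterises the projection of g1. *)
theory Submission
  imports Defs
begin

text \<open>Expanding the square around \<open>p\<close> leaves a cross term that \<open>vi\<close>
  makes nonnegative, so moving from \<open>p\<close> to a feasible \<open>d\<close> costs at least
  \<open>(norm (d - p))\<^sup>2\<close>. This surplus gives minimality and uniqueness at
  once.\<close>

lemma arg_min_norm_eq_singleton:
  fixes g p :: "'a::real_inner"
  assumes p: "P p" and vi: "\<And>d. P d \<Longrightarrow> (p - g) \<bullet> (d - p) \<ge> 0"
  shows "{d. is_arg_min (\<lambda>d. (norm (d - g))\<^sup>2) P d} = {p}"
proof -
  have pyth: "(norm (d - g))\<^sup>2 \<ge> (norm (p - g))\<^sup>2 + (norm (d - p))\<^sup>2" if "P d" for d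
  proof -
    have "(norm (d - g))\<^sup>2 = (norm (p - g))\<^sup>2 + 2 * ((p - g) \<bullet> (d - p)) + (norm (d - p))\<^sup>2"
      by (simp add: power2_norm_eq_inner inner_diff_left inner_diff_right inner_commute)
    with vi[OF that] show ?thesis by linarith
  qed
  have "is_arg_min (\<lambda>d. (norm (d - g))\<^sup>2) P p"
    unfolding is_arg_min_linorder using p pyth by (smt (verit) zero_le_power2)
  moreover have "d = p" if "is_arg_min (\<lambda>d. (norm (d - g))\<^sup>2) P d" for d
  proof -
    have "P d" "(norm (d - g))\<^sup>2 \<le> (norm (p - g))\<^sup>2"
      using that p by (auto simp: is_arg_min_linorder)
    with pyth[of d] have "(norm (d - p))\<^sup>2 \<le> 0" by linarith
    then show ?thesis by simp
  qed
  ultimately show ?thesis by blast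
qed

theorem corollary4p6:
  fixes \<tau> :: real and g1 g2 :: "real ^ 'n"
  assumes "0 \<le> \<tau>" and "\<tau> \<le> 1" and "g2 \<noteq> 0"
  shows "pcd_argmin \<tau> g1 g2 =
    {if g2 \<bullet> g1 \<ge> \<tau> * (norm g2)\<^sup>2 then g1
     else g1 + (\<tau> - (g2 \<bullet> g1) / (norm g2)\<^sup>2) *\<^sub>R g2}"
proof (cases "g2 \<bullet> g1 \<ge> \<tau> * (norm g2)\<^sup>2")
  case True
  \<comment> \<open>Here \<open>g1\<close> is itself feasible, and with \<open>p = g1\<close> the
    variational inequality reads 0 \<ge> 0.\<close>
  then have "pcd_argmin \<tau> g1 g2 = {g1}"
    unfolding pcd_argmin_def
    by (intro arg_min_norm_eq_singleton) (simp_all add: pcd_feasible_def)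
  with True show ?thesis by simp
next
  case False
  \<comment> \<open>The step length along \<open>g2\<close> at which the ray from \<open>g1\<close>
    meets the bounding hyperplane of the half-space.\<close>
  define c where "c = \<tau> - (g2 \<bullet> g1) / (norm g2)\<^sup>2"
  have pos: "(norm g2)\<^sup>2 > 0" using \<open>g2 \<noteq> 0\<close> by simp
  have c: "c \<ge> 0" using False pos by (simp add: c_def divide_le_eq)
  have active: "g2 \<bullet> (g1 + c *\<^sub>R g2) = \<tau> * (norm g2)\<^sup>2"
    using pos by (simp add: c_def inner_add_right left_diff_distrib flip: power2_norm_eq_inner)
  have "pcd_argmin \<tau> g1 g2 = {g1 + c *\<^sub>R g2}"
    unfolding pcd_argmin_def
  proof (rule arg_min_norm_eq_singleton)
    show "pcd_feasible \<tau> g2 (g1 + c *\<^sub>R g2)"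
      by (simp add: pcd_feasible_def active)
  next
    fix d assume "pcd_feasible \<tau> g2 d"
    \<comment> \<open>Since the constraint is tight at the new point, feasibility of
      \<open>d\<close> becomes a sign condition; scaling it by \<open>c\<close> gives the
      variational inequality.\<close>
    then have "g2 \<bullet> (d - (g1 + c *\<^sub>R g2)) \<ge> 0"
      unfolding pcd_feasible_def by (simp only: inner_diff_right active)
    with c show "(g1 + c *\<^sub>R g2 - g1) \<bullet> (d - (g1 + c *\<^sub>R g2)) \<ge> 0"
      by simp
  qed
  with False show ?thesis by (simp add: c_def)
qed

end
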